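(* Let $m$ and $n$ be positive integers, where $m$ is even. Then $$\sum_{\substack{R\cup S=[m]\\ |R|=|S|=m/2}}(-1)^{\sum_{r\in R}(r-1)}\sum_{\substack{I,J\subseteq[n],\ |I|=|J|=m/2\\ \lambda(J)/\lambda(I)\text{ horizontal strip}}}s_{\lambda(I)/\lambda(R)}(\mathbf x)\cdot s_{\lambda(J)/\lambda(S)}(\mathbf y)$$ $$=\operatorname{Pf}\left(\sum_{1\le k\le l\le n}\bigl(h_{k-i}(\mathbf x)\cdot h_{l-j}(\mathbf y)-h_{l-i}(\mathbf y)\cdot h_{k-j}(\mathbf x)\bigr)\right)_{1\le i,j\le m},$$ where for a set (written increasingly) $\{i_1<i_2<\dots<i_{m/2}\}$ we put $\lambda\bigl((i_1,i_2,\dots,i_{m/2})\bigr):=(i_{m/2}-\tfrac m2,\dots,i_2-2,i_1-1)$, and $\lambda/\mu$ is a horizontal strip if $\lambda_1\ge\mu_1\ge\lambda_2\ge\mu_2\ge\cdots$.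
   Context: $[n]=\{1,\dots,n\}$. $\mathbf x=(x_1,x_2,\dots)$ and $\mathbf y=(y_1,y_2,\dots)$ are infinite sequences of commuting variables. The complete homogeneous symmetric function is $h_n(\mathbf x)=\sum_{1\le i_1\le i_2\le\dots\le i_n}x_{i_1}x_{i_2}\cdots x_{i_n}$, with $h_0=1$ and $h_n=0$ for $n<0$. A partition is a non-increasing sequence $(\lambda_1,\dots,\lambda_\ell)$ of non-negative integers. For partitions $\lambda,\mu$ with $\ell$ parts (zeros allowed) the skew Schur function is $s_{\lambda/\mu}(\mathbf x)=\det\bigl(h_{\lambda_j-j-\mu_i+i}(\mathbf x)\bigr)_{1\le i,j\le\ell}$; if $\mu_i\le\lambda_i$ does not hold for all $i$, then $s_{\lambda/\mu}$ is still understood as this determinant (which is then $0$). Here all partitions have $\ell=m/2$ parts. For a skew-symmetric matrix $Y$ of even size $m$, the Pfaffian is $\operatorname{Pf}(Y)=\sum_{\mu}\operatorname{sgn}\mu\prod_{\{i,j\}\in\mu,\ i<j}Y_{i,j}$, the sum being over all perfect matchings $\mu$ of $[m]$, where $\operatorname{sgn}\mu=(-1)^{\mathrm{cr}(\mu)}$ and $\mathrm{cr}(\mu)$ is the number of quadruples $i<j<k<l$ such that $\{i,k\}$ and $\{j,l\}$ are pairs in $\mu$. *)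

theory Defs
  imports
    "HOL-Library.Multiset"
    "HOL-Library.Disjoint_Sets"
    "Jordan_Normal_Form.Determinant"
begin

text \<open>
  A monomial in variables indexed by \<open>'v\<close> is a finite multiset over \<open>'v\<close>, so that the
  product of monomials is multiset sum.  As every monomial has finitely many divisors,
  the Cauchy product makes sense also for infinite \<open>'v\<close>.
\<close>

typedef ('v, 'a) mps = "UNIV :: ('v multiset \<Rightarrow> 'a) set"
  morphisms mps_coeff Abs_mps ..

setup_lifting type_definition_mps

lemma mps_eqI: "(\<And>M. mps_coeff f M = mps_coeff g M) \<Longrightarrow> f = g"
  by (simp add: mps_coeff_inject[symmetric] fun_eq_iff)

lemma finite_submultisets: "finite {A. A \<subseteq># (M :: 'v multiset)}"
proof (rule finite_subset)
  show "{A. A \<subseteq># M} \<subseteq> mset ` {xs. set xs \<subseteq> set_mset M \<and> length xs \<le> size M}"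
  proof
    fix A assume "A \<in> {A. A \<subseteq># M}"
    moreover obtain xs where "A = mset xs" by (metis ex_mset)
    ultimately show "A \<in> mset ` {xs. set xs \<subseteq> set_mset M \<and> length xs \<le> size M}"
      by (auto intro!: imageI dest: set_mset_mono size_mset_mono simp flip: set_mset_mset size_mset
            simp del: set_mset_mset size_mset)
  qed
  show "finite (mset ` {xs. set xs \<subseteq> set_mset M \<and> length xs \<le> size M})"
    by (intro finite_imageI finite_lists_length_le) simp
qed

lemma finite_mset_splits: "finite {(A, B). A + B = (M :: 'v multiset)}"
  by (rule finite_subset[of _ "{A. A \<subseteq># M} \<times> {A. A \<subseteq># M}"])
     (auto simp: finite_submultisets)

lemma finite_mset_splits': "finite {p. fst p + snd p = (M :: 'v multiset)}"
  using finite_mset_splits[of M] by (simp add: case_prod_unfold)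

instantiation mps :: (type, comm_ring_1) comm_ring_1
begin

lift_definition zero_mps :: "('a, 'b) mps" is "\<lambda>M. 0" .
lift_definition one_mps :: "('a, 'b) mps" is "\<lambda>M. if M = {#} then 1 else 0" .
lift_definition uminus_mps :: "('a, 'b) mps \<Rightarrow> ('a, 'b) mps" is "\<lambda>f M. - f M" .
lift_definition plus_mps :: "('a, 'b) mps \<Rightarrow> ('a, 'b) mps \<Rightarrow> ('a, 'b) mps"
  is "\<lambda>f g M. f M + g M" .
lift_definition minus_mps :: "('a, 'b) mps \<Rightarrow> ('a, 'b) mps \<Rightarrow> ('a, 'b) mps"
  is "\<lambda>f g M. f M - g M" .
lift_definition times_mps :: "('a, 'b) mps \<Rightarrow> ('a, 'b) mps \<Rightarrow> ('a, 'b) mps"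
  is "\<lambda>f g M. \<Sum>(A, B) \<in> {(A, B). A + B = M}. f A * g B" .

instance
proof
  fix f g h :: "('a, 'b) mps"
  show "f * g * h = f * (g * h)"
  proof transfer
    fix f g h :: "'a multiset \<Rightarrow> 'b"
    show "(\<lambda>M. \<Sum>(A, B) \<in> {(A, B). A + B = M}.
              (\<Sum>(A, B) \<in> {(A', B'). A' + B' = A}. f A * g B) * h B) =
          (\<lambda>M. \<Sum>(A, B) \<in> {(A, B). A + B = M}.
              f A * (\<Sum>(A, B) \<in> {(A', B'). A' + B' = B}. g A * h B))"
    proof
      fix M :: "'a multiset"
      have "(\<Sum>(A, B) \<in> {(A, B). A + B = M}.
               (\<Sum>(A, B) \<in> {(A', B'). A' + B' = A}. f A * g B) * h B) =
            (\<Sum>(p, q) \<in> (SIGMA p : {(A, B). A + B = M}. {(A, B). A + B = fst p}).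
               f (fst q) * g (snd q) * h (snd p))"
        by (subst sum.Sigma[symmetric])
           (auto simp: finite_mset_splits' sum_distrib_right case_prod_unfold)
      also have "\<dots> = (\<Sum>(p, q) \<in> (SIGMA p : {(A, B). A + B = M}. {(A, B). A + B = snd p}).
               f (fst p) * (g (fst q) * h (snd q)))"
        by (rule sum.reindex_bij_witness[of _
              "\<lambda>(p, q). ((fst p + fst q, snd q), (fst p, fst q))"
              "\<lambda>(p, q). ((fst q, snd q + snd p), (snd q, snd p))"])
           (auto simp: algebra_simps)
      also have "\<dots> = (\<Sum>(A, B) \<in> {(A, B). A + B = M}.
              f A * (\<Sum>(A, B) \<in> {(A', B'). A' + B' = B}. g A * h B))"
        by (subst sum.Sigma[symmetric])
           (auto simp: finite_mset_splits' sum_distrib_left case_prod_unfold)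
      finally show "(\<Sum>(A, B) \<in> {(A, B). A + B = M}.
              (\<Sum>(A, B) \<in> {(A', B'). A' + B' = A}. f A * g B) * h B) =
          (\<Sum>(A, B) \<in> {(A, B). A + B = M}.
              f A * (\<Sum>(A, B) \<in> {(A', B'). A' + B' = B}. g A * h B))" .
    qed
  qed
  show "f * g = g * f"
  proof transfer
    fix f g :: "'a multiset \<Rightarrow> 'b"
    show "(\<lambda>M. \<Sum>(A, B) \<in> {(A, B). A + B = M}. f A * g B) =
          (\<lambda>M. \<Sum>(A, B) \<in> {(A, B). A + B = M}. g A * f B)"
      by (rule ext, rule sum.reindex_bij_witness[of _ prod.swap prod.swap])
         (auto simp: algebra_simps)
  qed
  show "1 * f = f"
  proof transfer
    fix f :: "'a multiset \<Rightarrow> 'b"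
    show "(\<lambda>M. \<Sum>(A, B) \<in> {(A, B). A + B = M}. (if A = {#} then 1 else 0) * f B) = f"
    proof
      fix M :: "'a multiset"
      have "(\<Sum>(A, B) \<in> {(A, B). A + B = M}. (if A = {#} then 1 else 0) * f B) =
            (\<Sum>(A, B) \<in> {({#} :: 'a multiset, M)}. (if A = {#} then 1 else 0) * f B)"
        by (rule sum.mono_neutral_right) (auto simp: finite_mset_splits split: if_splits)
      then show "(\<Sum>(A, B) \<in> {(A, B). A + B = M}. (if A = {#} then 1 else 0) * f B) = f M"
        by simp
    qed
  qed
  show "(f + g) * h = f * h + g * h"
    by transfer (simp add: fun_eq_iff algebra_simps case_prod_unfold sum.distrib)
  show "(0 :: ('a, 'b) mps) \<noteq> 1"
    by transfer (metis zero_neq_one)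
qed (transfer; simp add: fun_eq_iff algebra_simps)+

end

lift_definition mps_var :: "'v \<Rightarrow> ('v, 'a :: comm_ring_1) mps"
  is "\<lambda>v M. if M = {#v#} then 1 else 0" .

text \<open>
  Sum of a possibly infinite family, taken coefficientwise.  It is meaningful if each
  monomial occurs in only finitely many members of the family.
\<close>

definition formal_sum :: "('i \<Rightarrow> ('v, 'a :: comm_ring_1) mps) \<Rightarrow> 'i set \<Rightarrow> ('v, 'a) mps" where
  "formal_sum f I =
     Abs_mps (\<lambda>M. \<Sum>i | i \<in> I \<and> mps_coeff (f i) M \<noteq> 0. mps_coeff (f i) M)"

text \<open>
  Variables are numbered from 1: the entries with index 0 never occur in the symmetric
  functions below.
\<close>

definition x_vars :: "nat \<Rightarrow> (nat + nat, 'a :: comm_ring_1) mps" where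
  "x_vars i = mps_var (Inl i)"

definition y_vars :: "nat \<Rightarrow> (nat + nat, 'a :: comm_ring_1) mps" where
  "y_vars i = mps_var (Inr i)"

definition complete_hom ::
    "int \<Rightarrow> (nat \<Rightarrow> ('v, 'a :: comm_ring_1) mps) \<Rightarrow> ('v, 'a) mps" where
  "complete_hom n z =
     (if n < 0 then 0
      else formal_sum (\<lambda>is. \<Prod>i\<leftarrow>is. z i) {is. length is = nat n \<and> sorted is \<and> set is \<subseteq> {1..}})"

text \<open>
  For distinct variables each monomial comes from at most one sorted list of indices, so the
  formal sum in the definition is meaningful.
\<close>

lemma mps_coeff_prod_list_vars:
  "mps_coeff (\<Prod>i\<leftarrow>is. mps_var (v i) :: ('v, 'a :: comm_ring_1) mps) M =
     (if M = image_mset v (mset is) then 1 else 0)"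
proof (induction "is" arbitrary: M)
  case Nil
  show ?case by (simp add: one_mps.rep_eq)
next
  case (Cons i "is")
  let ?P = "image_mset v (mset is)"
  have "mps_coeff (\<Prod>j\<leftarrow>i # is. mps_var (v j) :: ('v, 'a) mps) M =
      (\<Sum>(A, B) \<in> {(A, B). A + B = M}.
         (if A = {#v i#} then 1 else 0) * (if B = ?P then 1 else 0))"
    by (simp add: times_mps.rep_eq mps_var.rep_eq Cons.IH)
  also have "\<dots> = (\<Sum>(A, B) \<in> {(A, B). A + B = M} \<inter> {({#v i#}, ?P)}. 1)"
    by (rule sum.mono_neutral_cong_right) (auto simp: finite_mset_splits split: if_splits)
  also have "\<dots> = (if M = add_mset (v i) ?P then 1 else 0)"
    by (cases "M = add_mset (v i) ?P") auto
  finally show ?case by simp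
qed

lemma mps_coeff_complete_hom:
  assumes "inj v"
  shows "mps_coeff (complete_hom (int n) (\<lambda>i. mps_var (v i)) :: ('v, 'a :: comm_ring_1) mps) M =
           (if size M = n \<and> set_mset M \<subseteq> v ` {1..} then 1 else 0)"
proof -
  let ?I = "{is. (length is = n \<and> sorted is \<and> set is \<subseteq> {1..}) \<and> M = image_mset v (mset is)}"
  have coeff: "mps_coeff (complete_hom (int n) (\<lambda>i. mps_var (v i)) :: ('v, 'a) mps) M =
      of_nat (card ?I)"
    by (simp add: complete_hom_def formal_sum_def Abs_mps_inverse mps_coeff_prod_list_vars
          if_distrib conj_ac cong: conj_cong)
  show ?thesis
  proof (cases "size M = n \<and> set_mset M \<subseteq> v ` {1..}")
    case True
    define N where "N = image_mset (inv_into UNIV v) M"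
    have M: "M = image_mset v N"
      unfolding N_def using True by (induction M arbitrary: n) (auto simp: f_inv_into_f)
    have N: "size N = n" "set_mset N \<subseteq> {1..}"
      using True assms by (auto simp: N_def)
    have "?I = {sorted_list_of_multiset N}"
    proof (intro equalityI subsetI)
      fix "is" assume "is \<in> ?I"
      then have "sorted is" "mset is = N"
        using M injD[OF multiset.inj_map[OF assms], of N "mset is"] by auto
      then show "is \<in> {sorted_list_of_multiset N}"
        by (metis sorted_list_of_multiset_mset sorted_sort_id singletonI)
    next
      fix "is" assume "is \<in> {sorted_list_of_multiset N}"
      then show "is \<in> ?I"
        using M N by (auto simp flip: size_mset)
    qed
    then show ?thesis using True by (simp add: coeff)
  next
    case False
    then have "?I = {}" by (auto intro!: imageI)
    then show ?thesis using False by (simp only: coeff) simp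
  qed
qed

text \<open>
  Partitions are lists of parts in non-increasing order, trailing zeros included.  Both lists
  are meant to have the same length.  List and matrix indices start at 0, which does not
  affect the differences of indices below.
\<close>

definition skew_schur ::
    "nat list \<Rightarrow> nat list \<Rightarrow> (nat \<Rightarrow> ('v, 'a :: comm_ring_1) mps) \<Rightarrow> ('v, 'a) mps" where
  "skew_schur lam mu z =
     det (mat (length lam) (length lam)
       (\<lambda>(i, j). complete_hom (int (lam ! j) - int j - int (mu ! i) + int i) z))"

definition horizontal_strip :: "nat list \<Rightarrow> nat list \<Rightarrow> bool" where
  "horizontal_strip lam mu \<longleftrightarrow>
     (\<forall>k < length lam. mu ! k \<le> lam ! k) \<and>
     (\<forall>k. Suc k < length lam \<longrightarrow> lam ! Suc k \<le> mu ! k)"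

text \<open>
  For a set of positive integers the k-th smallest element (k counted from 1) is at least k,
  so the subtraction is never truncated.
\<close>

definition partition_of_set :: "nat set \<Rightarrow> nat list" where
  "partition_of_set I = rev (map (\<lambda>k. sorted_list_of_set I ! k - Suc k) [0..<card I])"

definition perfect_matchings :: "nat set \<Rightarrow> nat set set set" where
  "perfect_matchings A = {P. partition_on A P \<and> (\<forall>e \<in> P. card e = 2)}"

definition crossings :: "nat set set \<Rightarrow> nat" where
  "crossings P = card {(i, j, k, l). i < j \<and> j < k \<and> k < l \<and> {i, k} \<in> P \<and> {j, l} \<in> P}"

text \<open>
  Only entries above the diagonal are used; the definition is meant for even \<open>m\<close> and
  skew-symmetric \<open>Y\<close>, with indices starting at 1.
\<close>

definition pfaffian :: "nat \<Rightarrow> (nat \<Rightarrow> nat \<Rightarrow> 'a :: comm_ring_1) \<Rightarrow> 'a" where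
  "pfaffian m Y =
     (\<Sum>P \<in> perfect_matchings {1..m}. (-1) ^ crossings P * (\<Prod>e \<in> P. Y (Min e) (Max e)))"

end

theory Submission
  imports Defs
begin

text \<open>
  Put \<open>X\<^sub>i\<^sub>k = h\<^sub>k\<^sub>-\<^sub>i(x)\<close>, \<open>Y\<^sub>j\<^sub>l = h\<^sub>l\<^sub>-\<^sub>j(y)\<close> and \<open>T\<^sub>k\<^sub>l = 1\<close> if \<open>k \<le> l\<close>, and \<open>0\<close> otherwise.  All three
  ingredients of the inner sum are minors.  After reversal of rows and columns, the determinant
  that defines \<open>s(\<lambda>(I)/\<lambda>(R))\<close> is the minor of \<open>X\<close> with rows \<open>R\<close> and columns \<open>I\<close>
  (\<open>skew_schur_eq_minor\<close>).  The diagram \<open>\<lambda>(J)/\<lambda>(I)\<close> is a horizontal strip exactly if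
  \<open>I\<^sub>1 \<le> J\<^sub>1 < I\<^sub>2 \<le> J\<^sub>2 < \<dots>\<close>, and the minor of \<open>T\<close> with rows \<open>I\<close> and columns \<open>J\<close> is the indicator
  of this condition (\<open>minor_order_indicator\<close>).  Two applications of the Cauchy-Binet formula
  therefore turn the inner sum into the minor of \<open>Z = X T Y\<^sup>t\<close> with rows \<open>R\<close> and columns \<open>S\<close>.

  The matrix on the right-hand side is \<open>Z - Z\<^sup>t\<close>, so what remains holds for every square matrix
  \<open>Z\<close> of even size over a commutative ring (\<open>pfaffian_antisymmetrization\<close>): the signed sum of the
  minors on complementary row and column sets of equal size is the Pfaffian of \<open>Z - Z\<^sup>t\<close>.
  Multiplying out \<open>\<Prod> (Z\<^sub>i\<^sub>j - Z\<^sub>j\<^sub>i)\<close> over the edges of a matching chooses an orientation of each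
  edge; the tails of the edges form \<open>R\<close>, the heads form \<open>S\<close>, and the edges themselves are a
  bijection \<open>R \<rightarrow> S\<close>, that is, a term of the Leibniz expansion of the minor.  The signs agree
  (\<open>matching_sign\<close>) because each of them is a product of signs attached to single edges and to pairs
  of edges, depending only on relative position; this reduces the comparison to two edges
  (\<open>crossing_parity\<close>).
\<close>

section \<open>Enumeration of finite sets\<close>

definition nth_elem :: "nat set \<Rightarrow> nat \<Rightarrow> nat" where
  "nth_elem I k = sorted_list_of_set I ! k"

lemma nth_elem_less:
  assumes "a < b" "b < card I"
  shows "nth_elem I a < nth_elem I b"
proof -
  have "sorted_wrt (<) (sorted_list_of_set I)"
    by (simp add: strict_sorted_list_of_set)
  from sorted_wrt_nth_less[OF this assms(1)] assms(2) show ?thesis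
    by (simp add: nth_elem_def)
qed

lemma bij_betw_nth_elem:
  assumes "finite I"
  shows "bij_betw (nth_elem I) {0..<card I} I"
  unfolding nth_elem_def
  using bij_betw_nth[of "sorted_list_of_set I" "{..<card I}" I] assms
  by (simp add: atLeast0LessThan)

section \<open>The sign of a permutation counts inversions\<close>

definition index_pairs :: "nat \<Rightarrow> (nat \<times> nat) set" where
  "index_pairs n = {(a, b). a < b \<and> b < n}"

lemma finite_index_pairs [simp]: "finite (index_pairs n)"
  by (rule finite_subset[of _ "{..<n} \<times> {..<n}"]) (auto simp: index_pairs_def)

text \<open>
  The sign \<open>(-1)\<close> to the power of the truth value of \<open>P\<close>.  Parity arguments become identities
  between products, which rewrite and reindex more easily than congruences between cardinalities.
\<close>

definition flip :: "bool \<Rightarrow> 'a :: comm_ring_1" where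
  "flip P = (if P then - 1 else 1)"

lemma flip_simps [simp]: "flip True = - 1" "flip False = 1"
  by (simp_all add: flip_def)

lemma prod_flip: "finite A \<Longrightarrow> (\<Prod>x\<in>A. flip (P x)) = (- 1) ^ card {x \<in> A. P x}"
  by (simp add: flip_def prod.If_cases Int_def conj_commute)

text \<open>
  The inversions of the transposition of \<open>c < d\<close> are \<open>(c, d)\<close> itself and, for each \<open>b\<close> strictly between
  \<open>c\<close> and \<open>d\<close>, the two pairs \<open>(c, b)\<close> and \<open>(b, d)\<close>: an odd number.
\<close>

lemma inversions_transpose:
  assumes "c < d" "d < n"
  shows "(\<Prod>(a, b)\<in>index_pairs n. flip (transpose c d b < transpose c d a)) = (- 1 :: int)"
proof -
  let ?inv = "{x \<in> index_pairs n. transpose c d (snd x) < transpose c d (fst x)}"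
  have "transpose c d b < transpose c d a \<longleftrightarrow> a = c \<and> b \<le> d \<or> b = d \<and> c \<le> a" if "a < b" for a b
    using assms that by (cases "a = c"; cases "a = d"; cases "b = c"; cases "b = d") auto
  then have "?inv = insert (c, d) ({c} \<times> {c<..<d} \<union> {c<..<d} \<times> {d})"
    using assms by (auto simp: index_pairs_def)
  moreover have "card ({c} \<times> {c<..<d} \<union> {c<..<d} \<times> {d}) = 2 * (d - Suc c)"
    by (subst card_Un_disjoint) auto
  moreover have "(c, d) \<notin> {c} \<times> {c<..<d} \<union> {c<..<d} \<times> {d}"
    by auto
  ultimately have "card ?inv = Suc (2 * (d - Suc c))"
    by simp
  then show ?thesis
    by (simp add: prod_flip case_prod_unfold)
qed

text \<open>
  Whether \<open>p\<close> reverses the order of two points is a property of the unordered pair.  So \<open>p \<circ> q\<close>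
  inverts a pair exactly if one, but not both, of these happens: \<open>q\<close> reverses the pair, and \<open>p\<close>
  reverses its image under \<open>q\<close>.  As \<open>q\<close> permutes the unordered pairs, the product over the images
  is the product for \<open>p\<close>.
\<close>

lemma inversions_compose:
  assumes p: "p permutes {0..<n}" and q: "q permutes {0..<n}"
  shows "(\<Prod>(a, b)\<in>index_pairs n. flip ((p \<circ> q) b < (p \<circ> q) a)) =
    (\<Prod>(a, b)\<in>index_pairs n. flip (p b < p a)) *
    (\<Prod>(a, b)\<in>index_pairs n. flip (q b < q a) :: int)"
proof -
  have qn: "q a < n \<longleftrightarrow> a < n" for a
    using permutes_in_image[OF q, of a] by simp
  have qi: "inv_into UNIV q a < n \<longleftrightarrow> a < n" for a
    using permutes_in_image[OF permutes_inv[OF q], of a] by simp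
  have inj: "p a = p b \<longleftrightarrow> a = b" "q a = q b \<longleftrightarrow> a = b" "inv_into UNIV q a = inv_into UNIV q b \<longleftrightarrow> a = b" for a b
    using permutes_inj[OF p] permutes_inj[OF q] permutes_inj[OF permutes_inv[OF q]]
    by (auto dest: injD)
  have canc: "q (inv_into UNIV q a) = a" "inv_into UNIV q (q a) = a" for a
    using q by (simp_all add: permutes_inverses)
  have "(\<Prod>(a, b)\<in>index_pairs n. flip (p b < p a)) =
      (\<Prod>(a, b)\<in>index_pairs n. flip ((p (q b) < p (q a)) \<noteq> (q b < q a)) :: int)"
    by (rule prod.reindex_bij_witness[of _
          "\<lambda>(a, b). (min (q a) (q b), max (q a) (q b))"
          "\<lambda>(a, b). (min (inv_into UNIV q a) (inv_into UNIV q b), max (inv_into UNIV q a) (inv_into UNIV q b))"])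
       (auto simp: index_pairs_def qn qi inj canc min_def max_def flip_def not_less le_less split: if_splits)
  then show ?thesis
    by (auto simp: prod.distrib[symmetric] flip_def intro!: prod.cong)
qed

lemma sign_eq_inversions:
  assumes "p permutes {0..<n}"
  shows "sign p = (\<Prod>(a, b)\<in>index_pairs n. flip (p b < p a))"
  using assms finite_atLeastLessThan
proof (induction rule: permutes_induct)
  case id
  have "(\<Prod>(a, b)\<in>index_pairs n. flip (id b < id a)) = (\<Prod>x\<in>index_pairs n. 1 :: int)"
    by (rule prod.cong) (auto simp: index_pairs_def)
  then show ?case
    by simp
next
  case (swap c d p)
  have "sign (transpose c d) = (\<Prod>(a, b)\<in>index_pairs n. flip (transpose c d b < transpose c d a))"
    using swap inversions_transpose[of c d n] inversions_transpose[of d c n]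
    by (cases c d rule: linorder_cases) (auto simp: sign_swap_id transpose_commute)
  moreover have "transpose c d permutes {0..<n}"
    using swap by (auto intro: permutes_swap_id)
  moreover have "sign (transpose c d \<circ> p) = sign (transpose c d) * sign p"
    using swap permutation_permutes by (intro sign_compose permutation_swap_id) blast
  ultimately show ?case
    using swap inversions_compose[of "transpose c d" n p] by (simp del: o_apply)
qed

section \<open>Minors and the Cauchy-Binet formula\<close>

definition minor :: "(nat \<Rightarrow> nat \<Rightarrow> 'a :: comm_ring_1) \<Rightarrow> nat set \<Rightarrow> nat set \<Rightarrow> 'a" where
  "minor A R S = det (mat (card R) (card R) (\<lambda>(a, b). A (nth_elem R a) (nth_elem S b)))"

lemma det_mat_leibniz:
  "det (mat p p (\<lambda>(a, b). A a b)) =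
     (\<Sum>\<sigma> | \<sigma> permutes {0..<p}. signof \<sigma> * (\<Prod>a = 0..<p. A a (\<sigma> a)))"
  by (subst det_def'[of _ p]) (auto intro!: sum.cong prod.cong dest: permutes_in_image)

lemma det_mat_permute_rows:
  assumes "\<sigma> permutes {0..<p}"
  shows "det (mat p p (\<lambda>(a, b). A (\<sigma> a) b)) = signof \<sigma> * det (mat p p (\<lambda>(a, b). A a b))"
proof -
  have "mat p p (\<lambda>(a, b). A (\<sigma> a) b) = mat p p (\<lambda>(a, b). mat p p (\<lambda>(a, b). A a b) $$ (\<sigma> a, b))"
    using permutes_in_image[OF assms] by (intro eq_matI) auto
  then show ?thesis
    using assms by (simp add: det_permute_rows)
qed

lemma det_mat_transpose:
  "det (mat p p (\<lambda>(a, b). A b a)) = det (mat p p (\<lambda>(a, b). A a b))"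
proof -
  have "mat p p (\<lambda>(a, b). A b a) = transpose_mat (mat p p (\<lambda>(a, b). A a b))"
    by (intro eq_matI) auto
  then show ?thesis
    by (simp add: det_transpose[of _ p])
qed

lemma det_mat_equal_rows:
  assumes "i < p" "j < p" "i \<noteq> j" "\<And>b. b < p \<Longrightarrow> A i b = A j b"
  shows "det (mat p p (\<lambda>(a, b). A a b)) = 0"
  using assms by (intro det_identical_rows[of _ p i j]) (auto intro!: eq_vecI)


text \<open>
  An injection from the row indices into \<open>K\<close> is its image \<open>I\<close> together with the order in which the
  elements of \<open>I\<close> are taken.  This groups the terms of the Cauchy-Binet formula by \<open>I\<close>.
\<close>

lemma bij_betw_subset_permutation_injection:
  assumes "finite K"
  shows "bij_betw (\<lambda>(I, \<tau>). \<lambda>a\<in>{0..<p}. nth_elem I (\<tau> a))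
    ({I. I \<subseteq> K \<and> card I = p} \<times> {\<tau>. \<tau> permutes {0..<p}})
    {f \<in> {0..<p} \<rightarrow>\<^sub>E K. inj_on f {0..<p}}" (is "bij_betw ?F (?\<I> \<times> ?\<P>) ?\<F>")
proof (rule bij_betw_imageI)
  have nth: "bij_betw (nth_elem I) {0..<p} I" if "I \<in> ?\<I>" for I
    using that assms bij_betw_nth_elem[of I] by (auto intro: finite_subset)
  have F: "bij_betw (?F (I, \<tau>)) {0..<p} I" if "I \<in> ?\<I>" "\<tau> \<in> ?\<P>" for I \<tau>
  proof -
    have "bij_betw (nth_elem I \<circ> \<tau>) {0..<p} I"
      using that by (intro bij_betw_trans[OF permutes_imp_bij nth]) auto
    then show ?thesis
      by (subst bij_betw_cong[where g = "nth_elem I \<circ> \<tau>"]) auto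
  qed
  show "inj_on ?F (?\<I> \<times> ?\<P>)"
  proof (rule inj_onI, clarify)
    fix I \<tau> I' \<tau>'
    assume I: "I \<subseteq> K" "p = card I" "I' \<subseteq> K" "card I' = card I"
      and \<tau>: "\<tau> permutes {0..<card I}" "\<tau>' permutes {0..<card I}"
      and eq: "(\<lambda>a\<in>{0..<card I}. nth_elem I (\<tau> a)) = (\<lambda>a\<in>{0..<card I}. nth_elem I' (\<tau>' a))"
    have "I = I'"
    proof -
      have "bij_betw (\<lambda>a\<in>{0..<card I}. nth_elem I (\<tau> a)) {0..<card I} I"
        using F[of I \<tau>] I \<tau> by simp
      moreover have "bij_betw (\<lambda>a\<in>{0..<card I}. nth_elem I' (\<tau>' a)) {0..<card I} I'"
        using F[of I' \<tau>'] I \<tau> by simp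
      ultimately show ?thesis
        unfolding eq by (metis bij_betw_imp_surj_on)
    qed
    moreover have "\<tau> a = \<tau>' a" for a
    proof (cases "a < card I")
      case True
      then have "nth_elem I (\<tau> a) = nth_elem I (\<tau>' a)"
        using eq \<open>I = I'\<close> by (auto dest!: fun_cong[of _ _ a])
      moreover have "\<tau> a \<in> {0..<card I}" "\<tau>' a \<in> {0..<card I}"
        using True \<tau> by (simp_all only: permutes_in_image) simp_all
      ultimately show ?thesis
        using nth[of I] I by (auto simp: bij_betw_def dest: inj_onD)
    next
      case False
      then show ?thesis using \<tau> by (simp add: permutes_not_in)
    qed
    ultimately show "I = I' \<and> \<tau> = \<tau>'" by auto
  qed
  show "?F ` (?\<I> \<times> ?\<P>) = ?\<F>"
  proof (intro equalityI subsetI)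
    fix f assume "f \<in> ?F ` (?\<I> \<times> ?\<P>)"
    then obtain I \<tau> where I: "I \<in> ?\<I>" "\<tau> \<in> ?\<P>" and f: "f = ?F (I, \<tau>)" by blast
    have "bij_betw f {0..<p} I"
      using F[OF I] f by simp
    moreover have "f \<in> extensional {0..<p}"
      by (simp add: f)
    ultimately show "f \<in> ?\<F>"
      using I by (auto simp: bij_betw_def PiE_def)
  next
    fix f assume f: "f \<in> ?\<F>"
    define I where "I = f ` {0..<p}"
    define \<tau> where "\<tau> a = (if a \<in> {0..<p} then inv_into {0..<p} (nth_elem I) (f a) else a)" for a
    have I: "I \<in> ?\<I>"
      using f by (auto simp: I_def card_image)
    have f_bij: "bij_betw f {0..<p} I"
      using f by (simp add: I_def bij_betw_def)
    have "bij_betw \<tau> {0..<p} {0..<p}"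
      using bij_betw_trans[OF f_bij bij_betw_inv_into[OF nth[OF I]]]
      by (rule bij_betw_cong[THEN iffD1, rotated]) (simp add: \<tau>_def)
    then have "\<tau> permutes {0..<p}"
      by (rule bij_imp_permutes) (auto simp: \<tau>_def)
    moreover have "?F (I, \<tau>) = f"
    proof
      fix a show "?F (I, \<tau>) a = f a"
        using f f_bij bij_betw_inv_into_right[OF nth[OF I], of "f a"]
        by (auto simp: \<tau>_def bij_betw_def PiE_def extensional_def I_def)
    qed
    ultimately show "f \<in> ?F ` (?\<I> \<times> ?\<P>)"
      using I by (metis (no_types, lifting) SigmaI image_eqI mem_Collect_eq)
  qed
qed

text \<open>
  Expanding the product of the row sums chooses a summation index \<open>f a\<close> for every row \<open>a\<close>.  If \<open>f\<close>
  is not injective, the rows \<open>f a\<close> of \<open>B\<close> contain a repetition and contribute \<open>0\<close>; otherwise \<open>f\<close> is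
  a subset with a permutation, and sorting the rows of \<open>B\<close> moves the sign of the permutation to \<open>A\<close>,
  where it completes the Leibniz sum.
\<close>

lemma cauchy_binet:
  fixes A B :: "nat \<Rightarrow> nat \<Rightarrow> 'a :: comm_ring_1"
  assumes "finite K"
  shows "det (mat p p (\<lambda>(a, b). \<Sum>k\<in>K. A a k * B k b)) =
    (\<Sum>I | I \<subseteq> K \<and> card I = p.
       det (mat p p (\<lambda>(a, b). A a (nth_elem I b))) * det (mat p p (\<lambda>(a, b). B (nth_elem I a) b)))"
proof -
  let ?P = "{\<sigma>. \<sigma> permutes {0..<p}}" and ?F = "{0..<p} \<rightarrow>\<^sub>E K"
  let ?rows = "\<lambda>f. det (mat p p (\<lambda>(a, b). B (f a) b))"
  have fin: "finite ?F" "finite ?P"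
    using assms by (auto intro: finite_PiE finite_permutations)
  have "det (mat p p (\<lambda>(a, b). \<Sum>k\<in>K. A a k * B k b)) =
      (\<Sum>\<sigma>\<in>?P. signof \<sigma> * (\<Sum>f\<in>?F. \<Prod>a = 0..<p. A a (f a) * B (f a) (\<sigma> a)))"
    by (subst det_mat_leibniz, subst prod_sum_PiE) (use assms in auto)
  also have "\<dots> = (\<Sum>f\<in>?F. (\<Prod>a = 0..<p. A a (f a)) * ?rows f)"
    by (subst det_mat_leibniz)
       (simp add: sum_distrib_left prod.distrib sum.swap[of _ ?P] mult.left_commute)
  also have "\<dots> = (\<Sum>f | f \<in> ?F \<and> inj_on f {0..<p}. (\<Prod>a = 0..<p. A a (f a)) * ?rows f)"
  proof (rule sum.mono_neutral_right[OF fin(1)])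
    have "?rows f = 0" if "\<not> inj_on f {0..<p}" for f
    proof -
      from that obtain i j where "i < p" "j < p" "i \<noteq> j" "f i = f j"
        by (auto simp: inj_on_def)
      then show ?thesis
        by (intro det_mat_equal_rows[of i p j]) auto
    qed
    then show "\<forall>f\<in>?F - {f \<in> ?F. inj_on f {0..<p}}. (\<Prod>a = 0..<p. A a (f a)) * ?rows f = 0"
      by auto
  qed auto
  also have "\<dots> = (\<Sum>(I, \<tau>)\<in>{I. I \<subseteq> K \<and> card I = p} \<times> ?P.
      (\<Prod>a = 0..<p. A a (nth_elem I (\<tau> a))) * det (mat p p (\<lambda>(a, b). B (nth_elem I (\<tau> a)) b)))"
  proof -
    have "mat p p (\<lambda>(a, b). B ((\<lambda>a\<in>{0..<p}. g a) a) b) = mat p p (\<lambda>(a, b). B (g a) b)" for g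
      by (intro eq_matI) auto
    then show ?thesis
      by (subst sum.reindex_bij_betw[OF bij_betw_subset_permutation_injection[OF assms], symmetric])
         (auto intro!: sum.cong prod.cong arg_cong2[of _ _ _ _ times])
  qed
  also have "\<dots> = (\<Sum>I | I \<subseteq> K \<and> card I = p. \<Sum>\<tau>\<in>?P.
      signof \<tau> * (\<Prod>a = 0..<p. A a (nth_elem I (\<tau> a))) * det (mat p p (\<lambda>(a, b). B (nth_elem I a) b)))"
    by (subst sum.cartesian_product[symmetric])
       (auto intro!: sum.cong simp: det_mat_permute_rows[where A = "\<lambda>a b. B (nth_elem _ a) b"])
  finally show ?thesis
    by (simp add: det_mat_leibniz[of p "\<lambda>a b. A a (nth_elem _ b)"] sum_distrib_right)
qed

section \<open>The inner sum is a minor\<close>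

lemma minor_mult:
  assumes "finite K"
  shows "minor (\<lambda>i j. \<Sum>k\<in>K. A i k * B k j) R S =
    (\<Sum>I | I \<subseteq> K \<and> card I = card R. minor A R I * minor B I S)"
  using cauchy_binet[OF assms, of "card R" "\<lambda>a. A (nth_elem R a)" "\<lambda>k b. B k (nth_elem S b)"]
  by (auto simp: minor_def intro!: sum.cong)

lemma minor_transpose:
  assumes "card R = card S"
  shows "minor (\<lambda>i j. A j i) S R = minor A R S"
  using det_mat_transpose[of "card R" "\<lambda>a b. A (nth_elem R a) (nth_elem S b)"] assms
  by (simp add: minor_def)

text \<open>
  The same permutation acts on rows and columns, so its sign occurs twice.  The Jacobi-Trudi
  matrix lists the elements of a set in decreasing order, a minor in increasing order.
\<close>

lemma det_mat_reverse:
  "det (mat p p (\<lambda>(a, b). A (p - Suc a) (p - Suc b))) = det (mat p p (\<lambda>(a, b). A a b))"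
proof -
  define \<rho> where "\<rho> a = (if a < p then p - Suc a else a)" for a
  have "bij_betw \<rho> {0..<p} {0..<p}"
    by (rule bij_betw_byWitness[where f' = \<rho>]) (auto simp: \<rho>_def)
  then have \<rho>: "\<rho> permutes {0..<p}"
    by (rule bij_imp_permutes) (simp add: \<rho>_def)
  have "mat p p (\<lambda>(a, b). A (p - Suc a) (p - Suc b)) = mat p p (\<lambda>(a, b). A (\<rho> a) (\<rho> b))"
    by (intro eq_matI) (auto simp: \<rho>_def)
  then have "det (mat p p (\<lambda>(a, b). A (p - Suc a) (p - Suc b))) =
      signof \<rho> * det (mat p p (\<lambda>(a, b). A a (\<rho> b)))"
    using det_mat_permute_rows[OF \<rho>, of "\<lambda>a b. A a (\<rho> b)"] by simp
  also have "det (mat p p (\<lambda>(a, b). A a (\<rho> b))) = det (mat p p (\<lambda>(b, a). A a (\<rho> b)))"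
    by (rule det_mat_transpose[symmetric, of p "\<lambda>a b. A a (\<rho> b)"])
  also have "\<dots> = signof \<rho> * det (mat p p (\<lambda>(b, a). A a b))"
    by (rule det_mat_permute_rows[OF \<rho>, of "\<lambda>b a. A a b"])
  also have "det (mat p p (\<lambda>(b, a). A a b)) = det (mat p p (\<lambda>(a, b). A a b))"
    by (rule det_mat_transpose)
  finally show ?thesis
    by (simp flip: mult.assoc of_int_mult)
qed

lemma Suc_le_nth_elem:
  assumes "finite I" "I \<subseteq> {1..}" "k < card I"
  shows "Suc k \<le> nth_elem I k"
  using assms(3)
proof (induction k)
  case 0
  have "nth_elem I 0 \<in> I"
    using bij_betw_nth_elem[OF assms(1)] 0 by (auto simp: bij_betw_def)
  then show ?case using assms(2) by auto
next
  case (Suc k)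
  then show ?case using nth_elem_less[of k "Suc k" I] by simp
qed

lemma length_partition_of_set [simp]: "length (partition_of_set I) = card I"
  by (simp add: partition_of_set_def)

lemma nth_partition_of_set:
  assumes "k < card I"
  shows "partition_of_set I ! k = nth_elem I (card I - Suc k) - Suc (card I - Suc k)"
  using assms by (simp add: partition_of_set_def nth_elem_def rev_nth)

text \<open>
  The shifts by the row and column number in the definition of a skew Schur function cancel those
  in the passage from a set to its partition, leaving differences of elements of \<open>I\<close> and \<open>R\<close>.
\<close>

lemma skew_schur_eq_minor:
  assumes I: "finite I" "I \<subseteq> {1..}" and R: "finite R" "R \<subseteq> {1..}" and card: "card I = card R"
  shows "skew_schur (partition_of_set I) (partition_of_set R) z =
    minor (\<lambda>i k. complete_hom (int k - int i) z) R I"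
proof -
  let ?p = "card R" and ?A = "\<lambda>a b. complete_hom (int (nth_elem I b) - int (nth_elem R a)) z"
  have "int (partition_of_set I ! b) - int b - int (partition_of_set R ! a) + int a =
      int (nth_elem I (?p - Suc b)) - int (nth_elem R (?p - Suc a))" if "a < ?p" "b < ?p" for a b
    using that card Suc_le_nth_elem[OF I, of "?p - Suc b"] Suc_le_nth_elem[OF R, of "?p - Suc a"]
    by (simp add: nth_partition_of_set of_nat_diff)
  then have "mat ?p ?p (\<lambda>(a, b). complete_hom
        (int (partition_of_set I ! b) - int b - int (partition_of_set R ! a) + int a) z) =
      mat ?p ?p (\<lambda>(a, b). ?A (?p - Suc a) (?p - Suc b))"
    by (intro eq_matI) auto
  then show ?thesis
    using det_mat_reverse[of ?p ?A] by (simp add: skew_schur_def minor_def card)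
qed

text \<open>
  Induction on the size through the last row.  If \<open>v q < u q\<close>, that row vanishes.  If \<open>u q \<le> v (q - 1)\<close>,
  the last two columns consist of ones only and are equal.  In the remaining case the last row is a unit vector,
  and its expansion leaves the matrix of the first \<open>q\<close> values.
\<close>

lemma det_interlacing:
  fixes u v :: "nat \<Rightarrow> nat"
  assumes "\<And>a b. a < b \<Longrightarrow> b < p \<Longrightarrow> u a < u b" and "\<And>a b. a < b \<Longrightarrow> b < p \<Longrightarrow> v a < v b"
  shows "det (mat p p (\<lambda>(a, b). if u a \<le> v b then 1 else 0)) =
    (if (\<forall>a<p. u a \<le> v a) \<and> (\<forall>a. Suc a < p \<longrightarrow> v a < u (Suc a)) then 1 else 0 :: 'a :: comm_ring_1)"
  using assms
proof (induction p)
  case 0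
  then show ?case by simp
next
  case (Suc q)
  let ?T = "\<lambda>p. mat p p (\<lambda>(a, b). if u a \<le> v b then 1 else 0) :: 'a mat"
  \<comment> \<open>Interlacing of the first \<open>q\<close> values does not extend to the last ones.\<close>
  let ?last = "v q < u q \<or> (\<exists>a. q = Suc a \<and> u q \<le> v a)"
  have le: "u a \<le> u b" "v a \<le> v b" if "a \<le> b" "b \<le> q" for a b
    using that Suc.prems[of a b] by (cases "a = b"; force)+
  have "det (?T (Suc q)) = (\<Sum>b<Suc q. ?T (Suc q) $$ (q, b) * cofactor (?T (Suc q)) q b)"
    by (rule laplace_expansion_row) auto
  also have "\<dots> = (if ?last then 0 else det (?T q))"
  proof -
    consider (zero) "v q < u q" | (ones) a where "q = Suc a" "u q \<le> v a" | (unit) "\<not> ?last"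
      by auto
    then show ?thesis
    proof cases
      case zero
      have "\<not> u q \<le> v b" if "b < Suc q" for b
        using zero le(2)[of b q] that by simp
      then show ?thesis
        using zero by (simp add: sum.neutral)
    next
      case ones
      have "u b \<le> v a \<and> u b \<le> v q" if "b < Suc q" for b
        using ones le[of b q] le[of a q] that by simp
      \<comment> \<open>The last two columns are equal; transposition makes them rows.\<close>
      then have "det (mat (Suc q) (Suc q) (\<lambda>(b, a). if u a \<le> v b then 1 else 0 :: 'a)) = 0"
        using ones(1) by (intro det_mat_equal_rows[of a _ q]) auto
      then have "det (?T (Suc q)) = 0"
        using det_mat_transpose[of "Suc q" "\<lambda>a b. if u a \<le> v b then 1 else 0 :: 'a"] by simp
      then show ?thesis
        using laplace_expansion_row[of "?T (Suc q)" "Suc q" q] ones by auto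
    next
      case unit
      have "\<not> u q \<le> v b" if "b < q" for b
        using unit that le(2)[of b "q - 1"] by (cases q) auto
      then have "(\<Sum>b<Suc q. ?T (Suc q) $$ (q, b) * cofactor (?T (Suc q)) q b) =
          cofactor (?T (Suc q)) q q"
        using unit by (simp add: sum.neutral)
      also have "mat_delete (?T (Suc q)) q q = ?T q"
        by (intro eq_matI) (auto simp: mat_delete_def)
      then have "cofactor (?T (Suc q)) q q = det (?T q)"
        by (simp add: cofactor_def)
      finally show ?thesis using unit by (simp only: if_False)
    qed
  qed
  also have "det (?T q) =
      (if (\<forall>a<q. u a \<le> v a) \<and> (\<forall>a. Suc a < q \<longrightarrow> v a < u (Suc a)) then 1 else 0)"
    by (rule Suc.IH) (auto intro: Suc.prems)
  also have "(if ?last then 0 else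
        if (\<forall>a<q. u a \<le> v a) \<and> (\<forall>a. Suc a < q \<longrightarrow> v a < u (Suc a)) then 1 else 0 :: 'a) =
      (if (\<forall>a<Suc q. u a \<le> v a) \<and> (\<forall>a. Suc a < Suc q \<longrightarrow> v a < u (Suc a)) then 1 else 0)"
    by (auto simp: less_Suc_eq not_less)
  finally show ?case .
qed

text \<open>
  Partitions list the shifted elements in decreasing order.  Undoing the reversal, the condition
  between consecutive parts compares elements whose shifts differ by one, which makes it strict.
\<close>

lemma horizontal_strip_iff_interlacing:
  assumes I: "finite I" "I \<subseteq> {1..}" and J: "finite J" "J \<subseteq> {1..}" and card: "card I = card J"
  shows "horizontal_strip (partition_of_set J) (partition_of_set I) \<longleftrightarrow>
    (\<forall>a<card I. nth_elem I a \<le> nth_elem J a) \<and>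
    (\<forall>a. Suc a < card I \<longrightarrow> nth_elem J a < nth_elem I (Suc a))"
proof -
  let ?p = "card I"
  have rev: "(\<forall>k<q. P (q - Suc k)) \<longleftrightarrow> (\<forall>a<q. P a)" for P and q :: nat
    by (metis Suc_diff_Suc diff_Suc_less diff_diff_cancel diff_less_Suc less_imp_Suc_add
        less_or_eq_imp_le not_less_eq zero_less_Suc)
  have le: "Suc k \<le> nth_elem I k" "Suc k \<le> nth_elem J k" if "k < ?p" for k
    using that card Suc_le_nth_elem[OF I, of k] Suc_le_nth_elem[OF J, of k] by auto
  have "(\<forall>k<?p. partition_of_set I ! k \<le> partition_of_set J ! k) \<longleftrightarrow>
      (\<forall>k<?p. nth_elem I (?p - Suc k) \<le> nth_elem J (?p - Suc k))"
  proof -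
    have "partition_of_set I ! k \<le> partition_of_set J ! k \<longleftrightarrow>
        nth_elem I (?p - Suc k) \<le> nth_elem J (?p - Suc k)" if "k < ?p" for k
      using that card le[of "?p - Suc k"] by (simp add: nth_partition_of_set) linarith
    then show ?thesis by simp
  qed
  moreover have "(\<forall>k<?p - 1. partition_of_set J ! Suc k \<le> partition_of_set I ! k) \<longleftrightarrow>
      (\<forall>k<?p - 1. nth_elem J (?p - 1 - Suc k) < nth_elem I (Suc (?p - 1 - Suc k)))"
  proof -
    have "partition_of_set J ! Suc k \<le> partition_of_set I ! k \<longleftrightarrow>
        nth_elem J (?p - 1 - Suc k) < nth_elem I (Suc (?p - 1 - Suc k))" if k: "k < ?p - 1" for k
    proof -
      obtain a where "?p - 1 = Suc (k + a)"
        using less_imp_Suc_add[OF k] by blast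
      then have a: "?p = Suc (Suc k) + a" by simp
      show ?thesis
        using a le[of a] le[of "Suc a"] card by (auto simp: nth_partition_of_set)
    qed
    then show ?thesis by simp
  qed
  ultimately show ?thesis
    using rev[of ?p "\<lambda>a. nth_elem I a \<le> nth_elem J a"]
      rev[of "?p - 1" "\<lambda>a. nth_elem J a < nth_elem I (Suc a)"]
    by (simp add: horizontal_strip_def card less_diff_conv)
qed

lemma minor_order_indicator:
  assumes I: "finite I" "I \<subseteq> {1..}" and J: "finite J" "J \<subseteq> {1..}" and card: "card I = card J"
  shows "minor (\<lambda>k l. if k \<le> l then 1 else 0) I J =
    (if horizontal_strip (partition_of_set J) (partition_of_set I) then 1 else 0 :: 'a :: comm_ring_1)"
  using det_interlacing[of "card I" "nth_elem I" "nth_elem J"] nth_elem_less card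
  by (simp add: minor_def horizontal_strip_iff_interlacing[OF assms])

text \<open>
  The strip condition becomes a factor, the corresponding minor of the matrix of the order relation;
  the double sum is then the Cauchy-Binet expansion of a product of three matrices.
\<close>

lemma sum_skew_schur_strips_eq_minor:
  fixes x y :: "nat \<Rightarrow> ('v, 'a :: comm_ring_1) mps"
  assumes R: "finite R" "R \<subseteq> {1..}" "card R = p" and S: "finite S" "S \<subseteq> {1..}" "card S = p"
  shows "(\<Sum>(I, J) \<in> {(I, J). I \<subseteq> {1..n} \<and> J \<subseteq> {1..n} \<and> card I = p \<and> card J = p \<and>
              horizontal_strip (partition_of_set J) (partition_of_set I)}.
            skew_schur (partition_of_set I) (partition_of_set R) x *
            skew_schur (partition_of_set J) (partition_of_set S) y) =
    minor (\<lambda>i j. \<Sum>k\<in>{1..n}. \<Sum>l\<in>{k..n}.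
        complete_hom (int k - int i) x * complete_hom (int l - int j) y) R S"
proof -
  let ?X = "\<lambda>i k. complete_hom (int k - int i) x" and ?Y = "\<lambda>j l. complete_hom (int l - int j) y"
  let ?T = "\<lambda>k l :: nat. if k \<le> l then 1 else 0 :: ('v, 'a) mps"
  let ?\<I> = "{I. I \<subseteq> {1..n} \<and> card I = p}"
  let ?strip = "\<lambda>(I, J). horizontal_strip (partition_of_set J) (partition_of_set I)"
  have sub: "finite I \<and> I \<subseteq> {1..} \<and> card I = p" if "I \<in> ?\<I>" for I
    using that by (auto intro: finite_subset)
  have fin: "finite ?\<I>"
    by (rule finite_subset[of _ "Pow {1..n}"]) auto
  have "minor (\<lambda>i j. \<Sum>k\<in>{1..n}. \<Sum>l\<in>{k..n}. ?X i k * ?Y j l) R S =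
      minor (\<lambda>i j. \<Sum>k\<in>{1..n}. ?X i k * (\<Sum>l\<in>{1..n}. ?T k l * ?Y j l)) R S"
  proof -
    have Y: "(\<Sum>l\<in>{k..n}. ?Y j l) = (\<Sum>l\<in>{1..n}. ?T k l * ?Y j l)" if "k \<in> {1..n}" for j k
      using that by (intro sum.mono_neutral_cong_left) auto
    have "(\<Sum>k\<in>{1..n}. \<Sum>l\<in>{k..n}. ?X i k * ?Y j l) =
        (\<Sum>k\<in>{1..n}. ?X i k * (\<Sum>l\<in>{1..n}. ?T k l * ?Y j l))" for i j
      unfolding sum_distrib_left[symmetric] by (intro sum.cong[OF refl] arg_cong[of _ _ "times _"] Y)
    then show ?thesis by (simp only:)
  qed
  also have "\<dots> = (\<Sum>I\<in>?\<I>. minor ?X R I *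
      (\<Sum>J\<in>?\<I>. minor ?T I J * minor (\<lambda>l j. ?Y j l) J S))"
    unfolding minor_mult[OF finite_atLeastAtMost] R(3) by (rule sum.cong[OF refl]) simp
  also have "\<dots> = (\<Sum>I\<in>?\<I>. \<Sum>J\<in>?\<I>. if ?strip (I, J) then
      skew_schur (partition_of_set I) (partition_of_set R) x *
      skew_schur (partition_of_set J) (partition_of_set S) y else 0)"
    unfolding sum_distrib_left
  proof (intro sum.cong refl)
    fix I J assume "I \<in> ?\<I>" "J \<in> ?\<I>"
    then have I: "finite I" "I \<subseteq> {1..}" "card I = p" and J: "finite J" "J \<subseteq> {1..}" "card J = p"
      using sub by blast+
    have "minor ?X R I = skew_schur (partition_of_set I) (partition_of_set R) x"
      using I R by (intro skew_schur_eq_minor[symmetric]) simp_all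
    moreover have "minor (\<lambda>l j. ?Y j l) J S = skew_schur (partition_of_set J) (partition_of_set S) y"
      using J S minor_transpose[of S J ?Y] skew_schur_eq_minor[of J S y] by simp
    moreover have "minor ?T I J = (if ?strip (I, J) then 1 else 0)"
      using minor_order_indicator[OF I(1,2) J(1,2)] I J by simp
    ultimately show "minor ?X R I * (minor ?T I J * minor (\<lambda>l j. ?Y j l) J S) =
      (if ?strip (I, J) then
        skew_schur (partition_of_set I) (partition_of_set R) x *
        skew_schur (partition_of_set J) (partition_of_set S) y else 0)"
      by (simp only: mult_1 mult_1_right mult_zero_left mult_zero_right split: if_split) simp
  qed
  also have "\<dots> = (\<Sum>(I, J)\<in>?\<I> \<times> ?\<I>. if ?strip (I, J) then
      skew_schur (partition_of_set I) (partition_of_set R) x *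
      skew_schur (partition_of_set J) (partition_of_set S) y else 0)"
    by (rule sum.cartesian_product)
  also have "\<dots> = (\<Sum>(I, J) \<in> {IJ \<in> ?\<I> \<times> ?\<I>. ?strip IJ}.
      skew_schur (partition_of_set I) (partition_of_set R) x *
      skew_schur (partition_of_set J) (partition_of_set S) y)"
    using fin by (intro sum.mono_neutral_cong_right) (auto split: if_splits)
  also have "{IJ \<in> ?\<I> \<times> ?\<I>. ?strip IJ} = {(I, J). I \<subseteq> {1..n} \<and> J \<subseteq> {1..n} \<and> card I = p \<and>
      card J = p \<and> horizontal_strip (partition_of_set J) (partition_of_set I)}"
    by auto
  finally show ?thesis by (rule sym)
qed

section \<open>The sign of an oriented matching\<close>

text \<open>
  The form in which the signs below are compared: one factor per edge and one per unordered pair of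
  edges.
\<close>

lemma prod_square_symmetrize:
  fixes g :: "nat \<Rightarrow> nat \<Rightarrow> 'a :: comm_monoid_mult"
  shows "(\<Prod>a = 0..<p. \<Prod>b = 0..<p. g a b) =
    (\<Prod>a = 0..<p. g a a) * (\<Prod>(a, b)\<in>index_pairs p. g a b * g b a)"
proof (induction p)
  case 0
  then show ?case by (simp add: index_pairs_def)
next
  case (Suc p)
  have "index_pairs (Suc p) = index_pairs p \<union> {0..<p} \<times> {p}"
    by (auto simp: index_pairs_def)
  moreover have "index_pairs p \<inter> {0..<p} \<times> {p} = {}"
    by (auto simp: index_pairs_def)
  ultimately have "(\<Prod>(a, b)\<in>index_pairs (Suc p). g a b * g b a) =
      (\<Prod>(a, b)\<in>index_pairs p. g a b * g b a) * (\<Prod>a = 0..<p. g a p * g p a)"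
    by (simp add: prod.union_disjoint prod.cartesian_product[symmetric])
  then show ?case
    using Suc.IH by (simp add: prod.distrib mult_ac)
qed

text \<open>
  A crossing is an ordered pair of edges, the one with the smaller minimum first, so it can be
  counted by indices of edges instead of quadruples of end points.
\<close>

lemma minus_one_power_crossings:
  fixes r t :: "nat \<Rightarrow> nat"
  assumes r: "inj_on r {0..<p}" and t: "inj_on t {0..<p}"
    and rt: "r ` {0..<p} \<inter> t ` {0..<p} = {}"
  defines "lo \<equiv> \<lambda>a. min (r a) (t a)" and "hi \<equiv> \<lambda>a. max (r a) (t a)"
  shows "(- 1) ^ crossings ((\<lambda>a. {r a, t a}) ` {0..<p}) =
    (\<Prod>a = 0..<p. \<Prod>b = 0..<p. flip (lo a < lo b \<and> lo b < hi a \<and> hi a < hi b) :: 'a :: comm_ring_1)"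
proof -
  \<comment> \<open>The ordered pairs of crossing edges, and the quadruples counted by \<open>crossings\<close>.\<close>
  let ?C = "{(a, b). a < p \<and> b < p \<and> lo a < lo b \<and> lo b < hi a \<and> hi a < hi b}"
  let ?X = "{(i, j, k, l). i < j \<and> j < k \<and> k < l \<and>
    {i, k} \<in> (\<lambda>a. {r a, t a}) ` {0..<p} \<and> {j, l} \<in> (\<lambda>a. {r a, t a}) ` {0..<p}}"
  have edge: "{i, k} \<in> (\<lambda>a. {r a, t a}) ` {0..<p} \<longleftrightarrow> (\<exists>a<p. i = lo a \<and> k = hi a)"
    if "i < k" for i k
  proof -
    have "{i, k} = {r a, t a} \<longleftrightarrow> i = lo a \<and> k = hi a" for a
      using that unfolding doubleton_eq_iff lo_def hi_def min_def max_def by auto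
    then show ?thesis by (auto simp: image_iff)
  qed
  have ne: "r a \<noteq> t b" if "a < p" "b < p" for a b
    using rt that by (metis disjoint_iff atLeastLessThan_iff imageI zero_le)
  have lo_inj: "a = b" if "lo a = lo b" "a < p" "b < p" for a b
    using that ne[of a b] ne[of b a] inj_onD[OF r, of a b] inj_onD[OF t, of a b]
    by (auto simp: lo_def min_def split: if_splits)
  have "bij_betw (\<lambda>(a, b). (lo a, lo b, hi a, hi b)) ?C ?X"
  proof (rule bij_betw_imageI)
    show "inj_on (\<lambda>(a, b). (lo a, lo b, hi a, hi b)) ?C"
      by (auto intro!: inj_onI lo_inj)
    show "(\<lambda>(a, b). (lo a, lo b, hi a, hi b)) ` ?C = ?X"
    proof (intro equalityI subsetI)
      fix x assume "x \<in> ?X"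
      then obtain i j k l where x: "x = (i, j, k, l)" and lt: "i < j" "j < k" "k < l"
        and "{i, k} \<in> (\<lambda>a. {r a, t a}) ` {0..<p}" "{j, l} \<in> (\<lambda>a. {r a, t a}) ` {0..<p}"
        by auto
      then obtain a b where "a < p" "i = lo a" "k = hi a" "b < p" "j = lo b" "l = hi b"
        using edge[of i k] edge[of j l] by auto
      then show "x \<in> (\<lambda>(a, b). (lo a, lo b, hi a, hi b)) ` ?C"
        using lt x by (intro image_eqI[of _ _ "(a, b)"]) auto
    next
      fix x assume "x \<in> (\<lambda>(a, b). (lo a, lo b, hi a, hi b)) ` ?C"
      then obtain a b where x: "x = (lo a, lo b, hi a, hi b)" and ab: "(a, b) \<in> ?C"
        by auto
      have "{lo a, hi a} \<in> (\<lambda>a. {r a, t a}) ` {0..<p}" "{lo b, hi b} \<in> (\<lambda>a. {r a, t a}) ` {0..<p}"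
        using ab edge[of "lo a" "hi a"] edge[of "lo b" "hi b"] by auto
      then show "x \<in> ?X"
        using ab x by simp
    qed
  qed
  then have "crossings ((\<lambda>a. {r a, t a}) ` {0..<p}) = card ?C"
    by (simp add: crossings_def bij_betw_same_card)
  also have "?C = {x \<in> {0..<p} \<times> {0..<p}. lo (fst x) < lo (snd x) \<and> lo (snd x) < hi (fst x) \<and> hi (fst x) < hi (snd x)}"
    by auto
  finally show ?thesis
    unfolding prod.cartesian_product case_prod_unfold by (simp only: prod_flip
        finite_cartesian_product finite_atLeastLessThan)
qed

text \<open>
  The local comparison behind the sign rule, for two disjoint edges with tails \<open>ra < rb\<close> and heads
  \<open>ta\<close>, \<open>tb\<close>.  The left-hand side collects the inversion of the heads and the contributions of the
  two edges to the ranks of their tails; its leading minus sign comes from \<open>ra\<close> preceding \<open>rb\<close>.  It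
  is checked for each of the twelve orders of the four end points.
\<close>

lemma crossing_parity:
  fixes ra rb ta tb :: nat
  assumes "ra < rb" "ta \<noteq> tb" "ra \<noteq> ta" "ra \<noteq> tb" "rb \<noteq> ta" "rb \<noteq> tb"
  defines "la \<equiv> min ra ta" and "lb \<equiv> min rb tb" and "ha \<equiv> max ra ta" and "hb \<equiv> max rb tb"
  shows "- (flip (tb < ta) * flip (tb < ra) * flip (ta < rb)) =
    (flip (la < lb \<and> lb < ha \<and> ha < hb) * flip (lb < la \<and> la < hb \<and> hb < ha) :: 'a :: comm_ring_1)"
  using assms(1-6) unfolding la_def lb_def ha_def hb_def flip_def min_def max_def
  by (cases "ta < tb"; cases "ta < ra"; cases "tb < ra"; cases "ta < rb"; cases "tb < rb") simp_all

text \<open>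
  In \<open>{1..m}\<close> there are \<open>v - 1\<close> points before \<open>v\<close>, each of them a tail or a head of exactly one edge.
  This distributes the sign of the row set over pairs of edges.
\<close>

lemma minus_one_power_rank:
  fixes r t :: "nat \<Rightarrow> nat"
  assumes r: "inj_on r {0..<p}" and t: "inj_on t {0..<p}"
    and rt: "r ` {0..<p} \<inter> t ` {0..<p} = {}" and un: "r ` {0..<p} \<union> t ` {0..<p} = {1..m}"
    and v: "v \<in> {1..m}"
  shows "(\<Prod>b = 0..<p. flip (r b < v) * flip (t b < v)) = ((- 1) ^ (v - 1) :: 'a :: comm_ring_1)"
proof -
  have "(\<Prod>b = 0..<p. flip (r b < v) * flip (t b < v)) =
      (\<Prod>w\<in>r ` {0..<p}. flip (w < v)) * (\<Prod>w\<in>t ` {0..<p}. flip (w < v) :: 'a)"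
    using r t by (simp add: prod.distrib prod.reindex)
  also have "\<dots> = (\<Prod>w\<in>{1..m}. flip (w < v))"
    using rt by (simp add: prod.union_disjoint[symmetric] un)
  also have "\<dots> = (- 1) ^ card {w \<in> {1..m}. w < v}"
    by (simp add: prod_flip)
  also have "{w \<in> {1..m}. w < v} = {1..<v}"
    using v by auto
  finally show ?thesis by simp
qed

text \<open>
  The sign rule for the matching with edges \<open>r a \<rightarrow> s (\<sigma> a)\<close>.  All factors are expanded over pairs of
  edges; a pair of distinct edges then gives the same sign on both sides by \<open>crossing_parity\<close>, while
  a single edge contributes through the rank of its tail whether its head comes first.
\<close>

lemma matching_sign:
  fixes r s :: "nat \<Rightarrow> nat"
  assumes r: "\<And>a b. a < b \<Longrightarrow> b < p \<Longrightarrow> r a < r b" and s: "\<And>a b. a < b \<Longrightarrow> b < p \<Longrightarrow> s a < s b"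
    and rs: "r ` {0..<p} \<inter> s ` {0..<p} = {}" and un: "r ` {0..<p} \<union> s ` {0..<p} = {1..m}"
    and \<sigma>: "\<sigma> permutes {0..<p}"
  shows "(- 1) ^ (\<Sum>v\<in>r ` {0..<p}. v - 1) * signof \<sigma> =
    ((- 1) ^ crossings ((\<lambda>a. {r a, s (\<sigma> a)}) ` {0..<p}) * (\<Prod>a = 0..<p. flip (s (\<sigma> a) < r a)) :: 'a :: comm_ring_1)"
proof -
  define t where "t a = s (\<sigma> a)" for a
  define cross where "cross a b \<longleftrightarrow> min (r a) (t a) < min (r b) (t b) \<and>
    min (r b) (t b) < max (r a) (t a) \<and> max (r a) (t a) < max (r b) (t b)" for a b
  have \<sigma>p: "\<sigma> a < p \<longleftrightarrow> a < p" for a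
    using permutes_in_image[OF \<sigma>, of a] by simp
  have \<sigma>_img: "\<sigma> ` {0..<p} = {0..<p}"
    by (rule permutes_image[OF \<sigma>])
  have s_less: "s a < s b \<longleftrightarrow> a < b" if "a < p" "b < p" for a b
    using s[of a b] s[of b a] that by (cases a b rule: linorder_cases) auto
  have r_inj: "inj_on r {0..<p}" and s_inj: "inj_on s {0..<p}"
    by (intro linorder_inj_onI; metis r s less_irrefl atLeastLessThan_iff linear)+
  have t_inj: "inj_on t {0..<p}"
    using comp_inj_on[OF permutes_inj_on[OF \<sigma>], of s "{0..<p}"] s_inj
    by (simp add: \<sigma>_img t_def[abs_def] o_def)
  have t_img: "t ` {0..<p} = s ` {0..<p}"
    by (simp add: t_def[abs_def] \<sigma>_img image_image[of s \<sigma>, symmetric])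
  have rt: "r ` {0..<p} \<inter> t ` {0..<p} = {}" and un': "r ` {0..<p} \<union> t ` {0..<p} = {1..m}"
    using rs un by (simp_all add: t_img)
  have ne: "r a \<noteq> t b" if "a < p" "b < p" for a b
    using rt that by (metis disjoint_iff atLeastLessThan_iff imageI zero_le)
  have "(- 1) ^ (\<Sum>v\<in>r ` {0..<p}. v - 1) = (\<Prod>a = 0..<p. (- 1) ^ (r a - 1) :: 'a)"
    by (simp add: sum.reindex[OF r_inj] power_sum)
  also have "\<dots> = (\<Prod>a = 0..<p. \<Prod>b = 0..<p. flip (r b < r a) * flip (t b < r a))"
    using un' by (intro prod.cong refl minus_one_power_rank[OF r_inj t_inj rt un', symmetric]) auto
  also have "\<dots> = (\<Prod>a = 0..<p. flip (t a < r a)) *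
      (\<Prod>(a, b)\<in>index_pairs p. - (flip (t b < r a) * flip (t a < r b)))"
  proof -
    have "flip (r b < r a) * flip (t b < r a) * (flip (r a < r b) * flip (t a < r b)) =
        (- (flip (t b < r a) * flip (t a < r b)) :: 'a)" if "(a, b) \<in> index_pairs p" for a b
      using r[of a b] that by (simp add: index_pairs_def)
    then have "(\<Prod>(a, b)\<in>index_pairs p.
          flip (r b < r a) * flip (t b < r a) * (flip (r a < r b) * flip (t a < r b))) =
        (\<Prod>(a, b)\<in>index_pairs p. - (flip (t b < r a) * flip (t a < r b)) :: 'a)"
      by (intro prod.cong) auto
    then show ?thesis
      by (simp add: prod_square_symmetrize)
  qed
  finally have rank: "(- 1) ^ (\<Sum>v\<in>r ` {0..<p}. v - 1) = (\<Prod>a = 0..<p. flip (t a < r a)) *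
      (\<Prod>(a, b)\<in>index_pairs p. - (flip (t b < r a) * flip (t a < r b)) :: 'a)" .
  have "signof \<sigma> = (\<Prod>(a, b)\<in>index_pairs p. of_int (flip (\<sigma> b < \<sigma> a)) :: 'a)"
    by (simp add: sign_eq_inversions[OF \<sigma>] case_prod_unfold)
  also have "\<dots> = (\<Prod>(a, b)\<in>index_pairs p. flip (t b < t a))"
    by (intro prod.cong) (auto simp: index_pairs_def t_def s_less \<sigma>p flip_def)
  finally have sign: "signof \<sigma> = (\<Prod>(a, b)\<in>index_pairs p. flip (t b < t a) :: 'a)" .
  have "(- 1) ^ crossings ((\<lambda>a. {r a, t a}) ` {0..<p}) =
      (\<Prod>a = 0..<p. \<Prod>b = 0..<p. flip (cross a b) :: 'a)"
    unfolding cross_def by (rule minus_one_power_crossings[OF r_inj t_inj rt])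
  also have "\<dots> = (\<Prod>(a, b)\<in>index_pairs p. flip (cross a b) * flip (cross b a))"
  proof -
    have "\<not> cross a a" for a
      by (simp add: cross_def)
    then show ?thesis
      by (simp add: prod_square_symmetrize)
  qed
  also have "\<dots> = (\<Prod>(a, b)\<in>index_pairs p. - (flip (t b < t a) * flip (t b < r a) * flip (t a < r b)))"
  proof (intro prod.cong refl, clarify)
    fix a b assume ab: "(a, b) \<in> index_pairs p"
    then have "t a \<noteq> t b"
      using t_inj by (auto simp: index_pairs_def dest: inj_onD)
    then show "flip (cross a b) * flip (cross b a) =
        (- (flip (t b < t a) * flip (t b < r a) * flip (t a < r b)) :: 'a)"
      unfolding cross_def using ab r ne by (intro crossing_parity[symmetric]) (auto simp: index_pairs_def)
  qed
  finally show ?thesis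
    unfolding rank sign t_def[symmetric]
    by (simp add: prod.distrib[symmetric] case_prod_unfold mult_ac)
qed

section \<open>The Pfaffian of an antisymmetrized matrix\<close>

definition halvings :: "nat \<Rightarrow> (nat set \<times> nat set) set" where
  "halvings p = {(R, S). R \<union> S = {1..2 * p} \<and> card R = p \<and> card S = p}"

lemma halvingsD:
  assumes "(R, S) \<in> halvings p"
  shows "finite R" "finite S" "card R = p" "card S = p" "R \<union> S = {1..2 * p}" "R \<inter> S = {}"
proof -
  show un: "R \<union> S = {1..2 * p}" and card: "card R = p" "card S = p"
    using assms by (auto simp: halvings_def)
  then have "finite (R \<union> S)" by simp
  then show fin: "finite R" "finite S" by simp_all
  have "card (R \<union> S) + card (R \<inter> S) = card (R \<union> S)"
    using card_Un_Int[OF fin] card by (simp add: un)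
  then show "R \<inter> S = {}"
    using fin by (simp add: card_0_eq)
qed

definition edge :: "nat set \<Rightarrow> nat set \<Rightarrow> (nat \<Rightarrow> nat) \<Rightarrow> nat \<Rightarrow> nat set" where
  "edge R S \<sigma> a = {nth_elem R a, nth_elem S (\<sigma> a)}"

text \<open>
  An orientation of a matching is given by the set \<open>B\<close> of edges that point from the smaller to the
  larger end point.
\<close>

definition tail :: "nat set set \<Rightarrow> nat set \<Rightarrow> nat" where
  "tail B e = (if e \<in> B then Min e else Max e)"

definition head :: "nat set set \<Rightarrow> nat set \<Rightarrow> nat" where
  "head B e = (if e \<in> B then Max e else Min e)"

definition upward :: "nat set \<Rightarrow> nat set \<Rightarrow> (nat \<Rightarrow> nat) \<Rightarrow> nat set set" where
  "upward R S \<sigma> = edge R S \<sigma> ` {a \<in> {0..<card R}. nth_elem R a < nth_elem S (\<sigma> a)}"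

text \<open>
  When every edge is oriented from \<open>R\<close> to \<open>S\<close>, the set of upward edges alone recovers the element
  of \<open>R\<close> and the element of \<open>S\<close> on each edge.
\<close>

lemma edge_facts:
  assumes RS: "(R, S) \<in> halvings p" and \<sigma>: "\<sigma> permutes {0..<p}"
  shows "bij_betw (nth_elem R) {0..<p} R" "bij_betw (nth_elem S \<circ> \<sigma>) {0..<p} S"
    "inj_on (edge R S \<sigma>) {0..<p}"
    "\<And>a. a < p \<Longrightarrow> nth_elem R a \<noteq> nth_elem S (\<sigma> a)"
    "\<And>a. a < p \<Longrightarrow> edge R S \<sigma> a \<in> upward R S \<sigma> \<longleftrightarrow> nth_elem R a < nth_elem S (\<sigma> a)"
    "\<And>a. a < p \<Longrightarrow> tail (upward R S \<sigma>) (edge R S \<sigma> a) = nth_elem R a"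
    "\<And>a. a < p \<Longrightarrow> head (upward R S \<sigma>) (edge R S \<sigma> a) = nth_elem S (\<sigma> a)"
proof -
  note half = halvingsD[OF RS]
  show R: "bij_betw (nth_elem R) {0..<p} R"
    using bij_betw_nth_elem[OF half(1)] half(3) by simp
  have "bij_betw (nth_elem S) {0..<p} S"
    using bij_betw_nth_elem[OF half(2)] half(4) by simp
  then show S: "bij_betw (nth_elem S \<circ> \<sigma>) {0..<p} S"
    by (rule bij_betw_trans[OF permutes_imp_bij[OF \<sigma>]])
  have in_R: "nth_elem R a \<in> R" and in_S: "nth_elem S (\<sigma> a) \<in> S" if "a < p" for a
    using that bij_betwE[OF R] bij_betwE[OF S] by auto
  have ne: "nth_elem R a \<noteq> nth_elem S (\<sigma> b)" if "a < p" "b < p" for a b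
    using in_R[OF that(1)] in_S[OF that(2)] half(6) by auto
  then show "\<And>a. a < p \<Longrightarrow> nth_elem R a \<noteq> nth_elem S (\<sigma> a)" by simp
  show inj: "inj_on (edge R S \<sigma>) {0..<p}"
  proof (rule inj_onI)
    fix a b assume ab: "a \<in> {0..<p}" "b \<in> {0..<p}" "edge R S \<sigma> a = edge R S \<sigma> b"
    then have "nth_elem R a = nth_elem R b"
      using ne[of a b] ne[of b a] by (auto simp: edge_def doubleton_eq_iff)
    then show "a = b"
      using ab R by (auto simp: bij_betw_def dest: inj_onD)
  qed
  show up: "edge R S \<sigma> a \<in> upward R S \<sigma> \<longleftrightarrow> nth_elem R a < nth_elem S (\<sigma> a)" if "a < p" for a
    unfolding upward_def half(3)
    using that by (subst inj_on_image_mem_iff[OF inj]) auto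
  show "tail (upward R S \<sigma>) (edge R S \<sigma> a) = nth_elem R a" if "a < p" for a
    using ne[OF that that] by (simp add: tail_def up that) (simp add: edge_def)
  show "head (upward R S \<sigma>) (edge R S \<sigma> a) = nth_elem S (\<sigma> a)" if "a < p" for a
    using ne[OF that that] by (simp add: head_def up that) (simp add: edge_def)
qed

lemma edges_perfect_matching:
  assumes RS: "(R, S) \<in> halvings p" and \<sigma>: "\<sigma> permutes {0..<p}"
  shows "edge R S \<sigma> ` {0..<p} \<in> perfect_matchings {1..2 * p}"
proof -
  note e = edge_facts[OF RS \<sigma>] and half = halvingsD[OF RS]
  have "\<Union> (edge R S \<sigma> ` {0..<p}) = nth_elem R ` {0..<p} \<union> (nth_elem S \<circ> \<sigma>) ` {0..<p}"
    by (auto simp: edge_def)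
  also have "\<dots> = {1..2 * p}"
    using e(1,2) half(5) by (simp add: bij_betw_def)
  finally have "{1..2 * p} = \<Union> (edge R S \<sigma> ` {0..<p})" by simp
  moreover have "disjoint (edge R S \<sigma> ` {0..<p})"
  proof (rule disjointI, clarify)
    fix a b assume ab: "a \<in> {0..<p}" "b \<in> {0..<p}" "edge R S \<sigma> a \<noteq> edge R S \<sigma> b"
    have "nth_elem R a \<noteq> nth_elem R b" "nth_elem S (\<sigma> a) \<noteq> nth_elem S (\<sigma> b)"
      using ab inj_onD[OF bij_betw_imp_inj_on[OF e(1)], of a b]
        inj_onD[OF bij_betw_imp_inj_on[OF e(2)], of a b] by auto
    moreover have "nth_elem R a \<noteq> nth_elem S (\<sigma> b)" "nth_elem R b \<noteq> nth_elem S (\<sigma> a)"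
      using ab bij_betwE[OF e(1)] bij_betwE[OF e(2)] half(6) by fastforce+
    ultimately show "edge R S \<sigma> a \<inter> edge R S \<sigma> b = {}"
      by (auto simp: edge_def)
  qed
  moreover have "card (edge R S \<sigma> a) = 2" if "a < p" for a
    using e(4)[OF that] by (simp add: edge_def)
  moreover have "{} \<notin> edge R S \<sigma> ` {0..<p}"
    by (auto simp: edge_def)
  ultimately show ?thesis
    by (auto simp: perfect_matchings_def partition_on_def)
qed

lemma Min_Max_card_2:
  fixes e :: "nat set"
  assumes "card e = 2"
  shows "e = {Min e, Max e}" "Min e < Max e"
proof -
  obtain u v where "e = {u, v}" "u \<noteq> v"
    using assms by (auto simp: card_2_iff)
  then show "e = {Min e, Max e}" "Min e < Max e"
    by (auto simp: min_def max_def)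
qed

text \<open>
  This matches the terms of the minors on complementary sets with the terms of the multiplied out
  Pfaffian.  An oriented matching determines \<open>R\<close> as its set of tails, \<open>S\<close> as its set of heads, and
  \<open>\<sigma>\<close> by its edges.
\<close>

lemma bij_betw_oriented_matchings:
  "bij_betw (\<lambda>((R, S), \<sigma>). (edge R S \<sigma> ` {0..<p}, upward R S \<sigma>))
    (halvings p \<times> {\<sigma>. \<sigma> permutes {0..<p}})
    (SIGMA P:perfect_matchings {1..2 * p}. Pow P)" (is "bij_betw ?F ?D ?E")
proof (rule bij_betw_imageI)
  show "inj_on ?F ?D"
  proof (rule inj_onI)
    fix x y assume xy: "x \<in> ?D" "y \<in> ?D" "?F x = ?F y"
    obtain R S \<sigma> R' S' \<sigma>' where eqs: "x = ((R, S), \<sigma>)" "y = ((R', S'), \<sigma>')"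
      by (metis prod.exhaust)
    with xy have RS: "(R, S) \<in> halvings p" and RS': "(R', S') \<in> halvings p"
      and \<sigma>: "\<sigma> permutes {0..<p}" and \<sigma>': "\<sigma>' permutes {0..<p}"
      and P: "edge R S \<sigma> ` {0..<p} = edge R' S' \<sigma>' ` {0..<p}"
      and B: "upward R S \<sigma> = upward R' S' \<sigma>'"
      by auto
    note e = edge_facts[OF RS \<sigma>] and e' = edge_facts[OF RS' \<sigma>']
    \<comment> \<open>The set of tails recovers \<open>R\<close>, and then the edge at each tail recovers \<open>\<sigma>\<close>.\<close>
    have "tail (upward R S \<sigma>) ` edge R S \<sigma> ` {0..<p} = nth_elem R ` {0..<p}"
      unfolding image_image using e(6) by (intro image_cong) auto
    moreover have "tail (upward R' S' \<sigma>') ` edge R' S' \<sigma>' ` {0..<p} = nth_elem R' ` {0..<p}"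
      unfolding image_image using e'(6) by (intro image_cong) auto
    ultimately have R: "R = R'"
      using P B e(1) e'(1) by (simp add: bij_betw_def)
    then have S: "S = S'"
      using halvingsD(5,6)[OF RS] halvingsD(5,6)[OF RS'] by blast
    have "\<sigma> a = \<sigma>' a" for a
    proof (cases "a < p")
      case True
      then obtain b where b: "b < p" "edge R S \<sigma> a = edge R' S' \<sigma>' b"
        using P by (metis (no_types, lifting) atLeastLessThan_iff imageE imageI zero_le)
      have "nth_elem R a = nth_elem R b"
        using e(6)[OF True] e'(6)[OF b(1)] b(2) B R by simp
      then have "a = b"
        using e(1) True b(1) by (auto simp: bij_betw_def dest: inj_onD)
      then have "nth_elem S (\<sigma> a) = nth_elem S (\<sigma>' a)"
        using e(7)[OF True] e'(7)[OF b(1)] b(2) B S by simp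
      moreover have "inj_on (nth_elem S) {0..<p}"
        using bij_betw_nth_elem[of S] halvingsD[OF RS] by (simp add: bij_betw_def)
      moreover have "\<sigma> a \<in> {0..<p}" "\<sigma>' a \<in> {0..<p}"
        using True \<sigma> \<sigma>' by (simp_all only: permutes_in_image) simp_all
      ultimately show ?thesis
        by (auto dest: inj_onD)
    next
      case False
      then show ?thesis using \<sigma> \<sigma>' by (simp add: permutes_not_in)
    qed
    then show "x = y"
      using R S eqs by auto
  qed
  show "?F ` ?D = ?E"
  proof (intro equalityI subsetI)
    fix x assume "x \<in> ?F ` ?D"
    then obtain R S \<sigma> where RS: "(R, S) \<in> halvings p" and \<sigma>: "\<sigma> permutes {0..<p}"
      and x: "x = (edge R S \<sigma> ` {0..<p}, upward R S \<sigma>)" by auto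
    have "upward R S \<sigma> \<subseteq> edge R S \<sigma> ` {0..<p}"
      unfolding upward_def halvingsD(3)[OF RS] by auto
    then show "x \<in> ?E"
      using edges_perfect_matching[OF RS \<sigma>] x by simp
  next
    fix x assume "x \<in> ?E"
    then obtain P B where x: "x = (P, B)" and B: "B \<subseteq> P"
      and P: "partition_on {1..2 * p} P" and card2: "\<And>e. e \<in> P \<Longrightarrow> card e = 2"
      by (auto simp: perfect_matchings_def)
    define R where "R = tail B ` P"
    define S where "S = head B ` P"
    have edges: "e = {tail B e, head B e}" "tail B e \<noteq> head B e" if "e \<in> P" for e
      using Min_Max_card_2[OF card2[OF that]] by (auto simp: tail_def head_def)
    have unique: "e = e'" if "e \<in> P" "e' \<in> P" "v \<in> e" "v \<in> e'" for e e' v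
      using partition_onD2[OF P] that by (auto dest: disjointD)
    have tail_in: "tail B e \<in> e" and head_in: "head B e \<in> e" if "e \<in> P" for e
      using edges(1)[OF that] by blast+
    have fin: "finite P"
      using P by (rule finite_elements[rotated]) simp
    have tail_inj: "inj_on (tail B) P" and head_inj: "inj_on (head B) P"
      using unique tail_in head_in by (metis inj_onI)+
    have un: "R \<union> S = {1..2 * p}"
    proof -
      have "R \<union> S = (\<Union>e\<in>P. {tail B e, head B e})"
        by (auto simp: R_def S_def)
      also have "\<dots> = (\<Union>e\<in>P. e)"
        using edges(1) by (intro SUP_cong) auto
      finally show ?thesis using partition_onD1[OF P] by simp
    qed
    have disj: "R \<inter> S = {}"
      using unique tail_in head_in edges(2) by (fastforce simp: R_def S_def)
    have finRS: "finite R" "finite S"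
      using fin by (simp_all add: R_def S_def)
    have "card R = card P" "card S = card P"
      using tail_inj head_inj by (simp_all add: R_def S_def card_image)
    moreover have "card R + card S = 2 * p"
      using card_Un_disjoint[OF finRS disj] by (simp add: un)
    ultimately have RS: "(R, S) \<in> halvings p" and card: "card R = p" "card S = p"
      using un by (auto simp: halvings_def)
    have nthR: "bij_betw (nth_elem R) {0..<p} R" and nthS: "bij_betw (nth_elem S) {0..<p} S"
      using bij_betw_nth_elem[of R] bij_betw_nth_elem[of S] finRS card by simp_all
    \<comment> \<open>The edges are numbered by their tails, in increasing order; then \<open>\<sigma> a\<close> is the rank of the head of the \<open>a\<close>-th edge.\<close>
    define g where "g = inv_into P (tail B) \<circ> nth_elem R"
    have g: "bij_betw g {0..<p} P"
      unfolding g_def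
      by (rule bij_betw_trans[OF nthR bij_betw_inv_into]) (simp add: R_def bij_betw_def tail_inj)
    have tail_g: "tail B (g a) = nth_elem R a" if "a < p" for a
      using that bij_betwE[OF nthR] by (auto simp: g_def R_def f_inv_into_f)
    define \<sigma> where "\<sigma> a = (if a \<in> {0..<p} then inv_into {0..<p} (nth_elem S) (head B (g a)) else a)" for a
    have "bij_betw (inv_into {0..<p} (nth_elem S) \<circ> (head B \<circ> g)) {0..<p} {0..<p}"
      by (rule bij_betw_trans[OF bij_betw_trans[OF g] bij_betw_inv_into[OF nthS]])
         (simp add: S_def bij_betw_def head_inj)
    then have "bij_betw \<sigma> {0..<p} {0..<p}"
      by (rule bij_betw_cong[THEN iffD1, rotated]) (simp add: \<sigma>_def)
    then have \<sigma>: "\<sigma> permutes {0..<p}"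
      by (rule bij_imp_permutes) (auto simp: \<sigma>_def)
    have head_g: "head B (g a) = nth_elem S (\<sigma> a)" if "a < p" for a
    proof -
      have "head B (g a) \<in> S"
        using that bij_betwE[OF g] by (auto simp: S_def)
      then show ?thesis
        using that bij_betw_inv_into_right[OF nthS] by (simp add: \<sigma>_def)
    qed
    have edge: "edge R S \<sigma> a = g a" if "a < p" for a
      using edges(1)[of "g a"] that bij_betwE[OF g] by (simp add: edge_def tail_g head_g)
    have "edge R S \<sigma> ` {0..<p} = P"
      using edge g by (simp add: bij_betw_def cong: image_cong_simp)
    moreover have "upward R S \<sigma> = B"
    proof -
      have "nth_elem R a < nth_elem S (\<sigma> a) \<longleftrightarrow> g a \<in> B" if "a < p" for a
        using that Min_Max_card_2(2)[OF card2, of "g a"] bij_betwE[OF g]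
        by (auto simp: tail_g[symmetric] head_g[symmetric] tail_def head_def)
      then have "upward R S \<sigma> = g ` {a \<in> {0..<p}. g a \<in> B}"
        unfolding upward_def card using edge by (intro image_cong) auto
      also have "\<dots> = B"
        using B g by (auto simp: bij_betw_def)
      finally show ?thesis .
    qed
    ultimately have "?F ((R, S), \<sigma>) = x"
      using x by simp
    then show "x \<in> ?F ` ?D"
      using RS \<sigma> by (intro image_eqI[of _ _ "((R, S), \<sigma>)"]) auto
  qed
qed

text \<open>
  Each product of differences is expanded over the orientations of the matching, a reversed edge
  contributing a minus sign; the oriented matchings are then sorted by their sets of tails and heads.
\<close>

lemma pfaffian_antisymmetrization:
  fixes Z :: "nat \<Rightarrow> nat \<Rightarrow> 'a :: comm_ring_1"
  shows "(\<Sum>(R, S)\<in>halvings p. (- 1) ^ (\<Sum>r\<in>R. r - 1) * minor Z R S) =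
    pfaffian (2 * p) (\<lambda>i j. Z i j - Z j i)"
proof -
  let ?P = "{\<sigma>. \<sigma> permutes {0..<p}}" and ?M = "perfect_matchings {1..2 * p}"
  let ?term = "\<lambda>P B. (- 1) ^ crossings P *
    ((\<Prod>e\<in>B. Z (Min e) (Max e)) * (\<Prod>e\<in>P - B. - Z (Max e) (Min e)))"
  have fin_P: "finite P" if "P \<in> ?M" for P
    using that by (auto simp: perfect_matchings_def intro: finite_elements[rotated])
  have fin_M: "finite ?M"
    by (rule finite_subset[of _ "Pow (Pow {1..2 * p})"])
       (auto simp: perfect_matchings_def partition_on_def)
  have "pfaffian (2 * p) (\<lambda>i j. Z i j - Z j i) = (\<Sum>P\<in>?M. \<Sum>B\<in>Pow P. ?term P B)"
    unfolding pfaffian_def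
  proof (rule sum.cong[OF refl])
    fix P assume "P \<in> ?M"
    then show "(- 1) ^ crossings P * (\<Prod>e\<in>P. Z (Min e) (Max e) - Z (Max e) (Min e)) =
        (\<Sum>B\<in>Pow P. ?term P B)"
      using prod_add[OF fin_P, of P "\<lambda>e. Z (Min e) (Max e)" "\<lambda>e. - Z (Max e) (Min e)"]
      by (simp add: sum_distrib_left)
  qed
  also have "\<dots> = (\<Sum>(P, B)\<in>(SIGMA P:?M. Pow P). ?term P B)"
    using fin_M fin_P by (intro sum.Sigma) auto
  also have "\<dots> = (\<Sum>((R, S), \<sigma>)\<in>halvings p \<times> ?P.
      ?term (edge R S \<sigma> ` {0..<p}) (upward R S \<sigma>))"
    by (subst sum.reindex_bij_betw[OF bij_betw_oriented_matchings, symmetric])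
       (simp add: case_prod_unfold)
  also have "\<dots> = (\<Sum>((R, S), \<sigma>)\<in>halvings p \<times> ?P.
      (- 1) ^ (\<Sum>r\<in>R. r - 1) * (signof \<sigma> * (\<Prod>a = 0..<p. Z (nth_elem R a) (nth_elem S (\<sigma> a)))))"
  proof (rule sum.cong[OF refl], clarify)
    fix R S \<sigma> assume RS: "(R, S) \<in> halvings p" and \<sigma>: "\<sigma> permutes {0..<p}"
    note e = edge_facts[OF RS \<sigma>] and half = halvingsD[OF RS]
    let ?E = "edge R S \<sigma> ` {0..<p}" and ?B = "upward R S \<sigma>"
    have B: "?B \<subseteq> ?E"
      unfolding upward_def half(3) by auto
    have "(\<Prod>e\<in>?B. Z (Min e) (Max e)) * (\<Prod>e\<in>?E - ?B. - Z (Max e) (Min e)) =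
        (\<Prod>e\<in>?E. flip (e \<notin> ?B) * Z (tail ?B e) (head ?B e))"
      by (subst prod.subset_diff[OF B]) (simp_all add: tail_def head_def mult.commute)
    also have "\<dots> = (\<Prod>a = 0..<p. flip (nth_elem S (\<sigma> a) < nth_elem R a) *
        Z (nth_elem R a) (nth_elem S (\<sigma> a)))"
      unfolding prod.reindex[OF e(3)] using e(4)
      by (intro prod.cong) (auto simp: e flip_def)
    finally have weight: "(\<Prod>e\<in>?B. Z (Min e) (Max e)) * (\<Prod>e\<in>?E - ?B. - Z (Max e) (Min e)) =
        (\<Prod>a = 0..<p. flip (nth_elem S (\<sigma> a) < nth_elem R a)) *
        (\<Prod>a = 0..<p. Z (nth_elem R a) (nth_elem S (\<sigma> a)))"
      by (simp add: prod.distrib)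
    have imgs: "nth_elem R ` {0..<p} = R" "nth_elem S ` {0..<p} = S"
      using bij_betw_nth_elem[of R] bij_betw_nth_elem[of S] half by (auto simp: bij_betw_def)
    have "(- 1) ^ (\<Sum>r\<in>R. r - 1) * signof \<sigma> =
        ((- 1) ^ crossings ?E * (\<Prod>a = 0..<p. flip (nth_elem S (\<sigma> a) < nth_elem R a)) :: 'a)"
      using matching_sign[of p "nth_elem R" "nth_elem S" "2 * p" \<sigma>] nth_elem_less half \<sigma>
      unfolding imgs edge_def[abs_def] by simp
    then show "?term ?E ?B = (- 1) ^ (\<Sum>r\<in>R. r - 1) *
        (signof \<sigma> * (\<Prod>a = 0..<p. Z (nth_elem R a) (nth_elem S (\<sigma> a))))"
      unfolding weight by (simp add: mult.assoc[symmetric])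
  qed
  also have "\<dots> = (\<Sum>(R, S)\<in>halvings p. (- 1) ^ (\<Sum>r\<in>R. r - 1) *
      (\<Sum>\<sigma>\<in>?P. signof \<sigma> * (\<Prod>a = 0..<p. Z (nth_elem R a) (nth_elem S (\<sigma> a)))))"
    by (simp add: sum.cartesian_product case_prod_unfold sum_distrib_left)
  also have "\<dots> = (\<Sum>(R, S)\<in>halvings p. (- 1) ^ (\<Sum>r\<in>R. r - 1) * minor Z R S)"
    by (intro sum.cong refl, clarify) (simp add: minor_def det_mat_leibniz halvingsD(3))
  finally show ?thesis by (rule sym)
qed

section \<open>The Pfaffian formula for sums of products of skew Schur functions\<close>

theorem theorem20:
  fixes m n :: nat
  assumes "m > 0" and "n > 0" and "even m"
  shows "(\<Sum>(R, S) \<in> {(R, S). R \<union> S = {1..m} \<and> card R = m div 2 \<and> card S = m div 2}.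
            (-1) ^ (\<Sum>r\<in>R. r - 1) *
            (\<Sum>(I, J) \<in> {(I, J). I \<subseteq> {1..n} \<and> J \<subseteq> {1..n} \<and> card I = m div 2 \<and> card J = m div 2 \<and>
                                horizontal_strip (partition_of_set J) (partition_of_set I)}.
               skew_schur (partition_of_set I) (partition_of_set R) x_vars *
               skew_schur (partition_of_set J) (partition_of_set S) y_vars)) =
         (pfaffian m (\<lambda>i j. \<Sum>k\<in>{1..n}. \<Sum>l\<in>{k..n}.
            complete_hom (int k - int i) x_vars * complete_hom (int l - int j) y_vars -
            complete_hom (int l - int i) y_vars * complete_hom (int k - int j) x_vars)
          :: (nat + nat, 'a :: comm_ring_1) mps)"
proof -
  obtain p where m: "m = 2 * p"
    using \<open>even m\<close> by (rule evenE)
  let ?Z = "\<lambda>i j. \<Sum>k\<in>{1..n}. \<Sum>l\<in>{k..n}.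
    complete_hom (int k - int i) x_vars * complete_hom (int l - int j) y_vars
    :: (nat + nat, 'a) mps"
  have halves: "{(R, S). R \<union> S = {1..2 * p} \<and> card R = 2 * p div 2 \<and> card S = 2 * p div 2} = halvings p"
    by (simp add: halvings_def)
  have entries: "(\<Sum>k\<in>{1..n}. \<Sum>l\<in>{k..n}.
        complete_hom (int k - int i) x_vars * complete_hom (int l - int j) y_vars -
        complete_hom (int l - int i) y_vars * complete_hom (int k - int j) x_vars) =
      ?Z i j - ?Z j i" for i j
    by (simp add: sum_subtractf mult.commute)
  show ?thesis
    unfolding m halves entries pfaffian_antisymmetrization[where Z = ?Z, symmetric]
  proof (rule sum.cong[OF refl], clarify)
    fix R S assume RS: "(R, S) \<in> halvings p"
    note half = halvingsD[OF RS]
    have pos: "R \<subseteq> {1..}" "S \<subseteq> {1..}"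
      using half(5) by auto
    show "(- 1) ^ (\<Sum>r\<in>R. r - 1) *
        (\<Sum>(I, J) \<in> {(I, J). I \<subseteq> {1..n} \<and> J \<subseteq> {1..n} \<and> card I = 2 * p div 2 \<and> card J = 2 * p div 2 \<and>
            horizontal_strip (partition_of_set J) (partition_of_set I)}.
          skew_schur (partition_of_set I) (partition_of_set R) x_vars *
          skew_schur (partition_of_set J) (partition_of_set S) y_vars) =
        (- 1) ^ (\<Sum>r\<in>R. r - 1) * minor ?Z R S"
      using sum_skew_schur_strips_eq_minor[OF half(1) pos(1) half(3) half(2) pos(2) half(4),
          where n = n and x = "x_vars :: nat \<Rightarrow> (nat + nat, 'a) mps" and y = y_vars]
      by simp
  qed
qed

end
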